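(* The formula $$f(x+yI)=(I-K)(J-K)^{-1}f(x+yJ)+(I-J)(K-J)^{-1}f(x+yK)$$ does not hold, in general, for slice regular functions on non-axially symmetric s-domains; that is, there exist a non-axially symmetric s-domain $\Omega\subset\mathbb{H}$, a slice regular function $f:\Omega\to\mathbb{H}$, real numbers $x,y$ and $I,J,K\in\mathbb{S}$ with $J\neq K$ and $x+yI,\ x+yJ,\ x+yK\in\Omega$, for which the formula fails.
   Context: $\mathbb{H}$ denotes the quaternions and $\mathbb{S}=\{q\in\mathbb{H}: q^2=-1\}$. For $I\in\mathbb{S}$, $\mathbb{C}_I=\mathbb{R}+I\mathbb{R}$ and $\Omega_I:=\Omega\cap\mathbb{C}_I$. A set $\Omega\subset\mathbb{H}$ is an s-domain (classical slice domain) if $\Omega$ is a domain in the Euclidean topology of $\mathbb{H}$, $\Omega\cap\mathbb{R}\neq\varnothing$, and $\Omega_I$ is a domain in $\mathbb{C}_I$ for every $I\in\mathbb{S}$. $\Omega$ is axially symmetric if $x+yI\in\Omega$ ($x,y\in\mathbb{R}$, $I\in\mathbb{S}$) implies $x+yL\in\Omega$ for all $L\in\mathbb{S}$. A function $f:\Omega\to\mathbb{H}$ is slice regular if for every $I\in\mathbb{S}$ the restriction $f|_{\Omega_I}$ is left $\mathbb{C}_I$-holomorphic, i.e. has continuous partial derivatives and satisfies $\frac12\left(\frac{\partial}{\partial x}+I\frac{\partial}{\partial y}\right)f(x+yI)=0$ on $\Omega_I$. *)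

theory Defs
  imports "HOL-Analysis.Analysis"
begin

section \<open>The quaternions\<close>

codatatype quat = Quat (QRe: real) (QIm1: real) (QIm2: real) (QIm3: real)

lemma quat_eqI [intro?]:
  "\<lbrakk>QRe p = QRe q; QIm1 p = QIm1 q; QIm2 p = QIm2 q; QIm3 p = QIm3 q\<rbrakk> \<Longrightarrow> p = q"
  by (rule quat.expand) simp

lemma quat_eq_iff:
  "p = q \<longleftrightarrow> QRe p = QRe q \<and> QIm1 p = QIm1 q \<and> QIm2 p = QIm2 q \<and> QIm3 p = QIm3 q"
  by (auto intro: quat.expand)

instantiation quat :: ab_group_add
begin

primcorec zero_quat where
  "QRe 0 = 0" | "QIm1 0 = 0" | "QIm2 0 = 0" | "QIm3 0 = 0"

primcorec plus_quat where
  "QRe (p + q) = QRe p + QRe q"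
| "QIm1 (p + q) = QIm1 p + QIm1 q"
| "QIm2 (p + q) = QIm2 p + QIm2 q"
| "QIm3 (p + q) = QIm3 p + QIm3 q"

primcorec uminus_quat where
  "QRe (- p) = - QRe p"
| "QIm1 (- p) = - QIm1 p"
| "QIm2 (- p) = - QIm2 p"
| "QIm3 (- p) = - QIm3 p"

primcorec minus_quat where
  "QRe (p - q) = QRe p - QRe q"
| "QIm1 (p - q) = QIm1 p - QIm1 q"
| "QIm2 (p - q) = QIm2 p - QIm2 q"
| "QIm3 (p - q) = QIm3 p - QIm3 q"

instance
  by standard (simp_all add: quat_eq_iff)

end

instantiation quat :: ring_1
begin

primcorec one_quat where
  "QRe 1 = 1" | "QIm1 1 = 0" | "QIm2 1 = 0" | "QIm3 1 = 0"

primcorec times_quat where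
  "QRe (p * q) = QRe p * QRe q - QIm1 p * QIm1 q - QIm2 p * QIm2 q - QIm3 p * QIm3 q"
| "QIm1 (p * q) = QRe p * QIm1 q + QIm1 p * QRe q + QIm2 p * QIm3 q - QIm3 p * QIm2 q"
| "QIm2 (p * q) = QRe p * QIm2 q - QIm1 p * QIm3 q + QIm2 p * QRe q + QIm3 p * QIm1 q"
| "QIm3 (p * q) = QRe p * QIm3 q + QIm1 p * QIm2 q - QIm2 p * QIm1 q + QIm3 p * QRe q"

instance
  by standard (simp_all add: quat_eq_iff algebra_simps)

end

instantiation quat :: real_algebra_1
begin

primcorec scaleR_quat where
  "QRe (scaleR r q) = r * QRe q"
| "QIm1 (scaleR r q) = r * QIm1 q"
| "QIm2 (scaleR r q) = r * QIm2 q"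
| "QIm3 (scaleR r q) = r * QIm3 q"

instance
  by standard (simp_all add: quat_eq_iff algebra_simps)

end

instantiation quat :: real_div_algebra
begin

primcorec inverse_quat where
  "QRe (inverse q) = QRe q / ((QRe q)\<^sup>2 + (QIm1 q)\<^sup>2 + (QIm2 q)\<^sup>2 + (QIm3 q)\<^sup>2)"
| "QIm1 (inverse q) = - QIm1 q / ((QRe q)\<^sup>2 + (QIm1 q)\<^sup>2 + (QIm2 q)\<^sup>2 + (QIm3 q)\<^sup>2)"
| "QIm2 (inverse q) = - QIm2 q / ((QRe q)\<^sup>2 + (QIm1 q)\<^sup>2 + (QIm2 q)\<^sup>2 + (QIm3 q)\<^sup>2)"
| "QIm3 (inverse q) = - QIm3 q / ((QRe q)\<^sup>2 + (QIm1 q)\<^sup>2 + (QIm2 q)\<^sup>2 + (QIm3 q)\<^sup>2)"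

definition "(p :: quat) div q = p * inverse q"

instance
proof
  fix p q :: quat
  show "inverse q * q = 1" "q * inverse q = 1" if "q \<noteq> 0"
  proof -
    define n where "n = (QRe q)\<^sup>2 + (QIm1 q)\<^sup>2 + (QIm2 q)\<^sup>2 + (QIm3 q)\<^sup>2"
    have "n \<noteq> 0"
      using that unfolding n_def quat_eq_iff zero_quat.sel
      by (smt (verit) zero_eq_power2 zero_le_power2)
    then show "inverse q * q = 1" "q * inverse q = 1"
      by (simp_all add: quat_eq_iff n_def [symmetric] divide_simps)
         (simp_all add: n_def power2_eq_square)
  qed
  show "p div q = p * inverse q" by (simp add: divide_quat_def)
  show "inverse (0::quat) = 0" by (simp add: quat_eq_iff)
qed

end

instantiation quat :: real_inner
begin

definition "inner_quat p q = QRe p * QRe q + QIm1 p * QIm1 q + QIm2 p * QIm2 q + QIm3 p * QIm3 q"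
definition "norm_quat q = sqrt ((QRe q)\<^sup>2 + (QIm1 q)\<^sup>2 + (QIm2 q)\<^sup>2 + (QIm3 q)\<^sup>2)"
definition "sgn_quat (q :: quat) = q /\<^sub>R norm q"
definition "dist_quat (p :: quat) q = norm (p - q)"
definition [code del]:
  "(uniformity :: (quat \<times> quat) filter) = (INF e\<in>{0<..}. principal {(p, q). dist p q < e})"
definition [code del]:
  "open (U :: quat set) \<longleftrightarrow> (\<forall>p\<in>U. eventually (\<lambda>(p', q). p' = p \<longrightarrow> q \<in> U) uniformity)"

instance
proof
  fix p q r :: quat and a :: real and U :: "quat set"
  show "dist p q = norm (p - q)" by (rule dist_quat_def)
  show "sgn q = q /\<^sub>R norm q" by (rule sgn_quat_def)
  show "(uniformity :: (quat \<times> quat) filter) = (INF e\<in>{0<..}. principal {(p, q). dist p q < e})"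
    by (rule uniformity_quat_def)
  show "open U \<longleftrightarrow> (\<forall>p\<in>U. eventually (\<lambda>(p', q). p' = p \<longrightarrow> q \<in> U) uniformity)"
    by (rule open_quat_def)
  show "inner p q = inner q p" by (simp add: inner_quat_def mult.commute)
  show "inner (p + q) r = inner p r + inner q r" by (simp add: inner_quat_def algebra_simps)
  show "inner (a *\<^sub>R p) q = a * inner p q" by (simp add: inner_quat_def algebra_simps)
  show "0 \<le> inner q q" by (simp add: inner_quat_def)
  show "inner q q = 0 \<longleftrightarrow> q = 0"
    unfolding inner_quat_def quat_eq_iff zero_quat.sel power2_eq_square [symmetric]
    by (smt (verit) zero_eq_power2 zero_le_power2)
  show "norm q = sqrt (inner q q)" by (simp add: inner_quat_def norm_quat_def power2_eq_square)
qed

end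

instance quat :: real_normed_div_algebra
proof
  fix p q :: quat
  show "norm (p * q) = norm p * norm q"
    unfolding norm_quat_def real_sqrt_mult [symmetric]
    by (rule arg_cong [where f = sqrt]) (simp add: power2_eq_square algebra_simps)
qed

instantiation quat :: euclidean_space
begin

definition "Basis_quat = {Quat 1 0 0 0, Quat 0 1 0 0, Quat 0 0 1 0, Quat 0 0 0 1}"

instance
proof
  fix q :: quat
  show "(\<forall>u\<in>Basis. inner q u = 0) \<longleftrightarrow> q = 0"
    unfolding quat_eq_iff [of q 0] by (auto simp: Basis_quat_def inner_quat_def)
qed (auto simp: Basis_quat_def inner_quat_def)

end

section \<open>Slice regular functions\<close>

definition imag_units :: "quat set" where
  "imag_units = {q. q\<^sup>2 = - 1}"

definition slice_point :: "real \<Rightarrow> real \<Rightarrow> quat \<Rightarrow> quat" where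
  "slice_point x y I = of_real x + of_real y * I"

definition slice_plane :: "quat \<Rightarrow> quat set" where
  "slice_plane I = {slice_point x y I | x y. True}"

definition s_domain :: "quat set \<Rightarrow> bool" where
  "s_domain \<Omega> \<longleftrightarrow>
     open \<Omega> \<and> connected \<Omega> \<and> \<Omega> \<inter> \<real> \<noteq> {} \<and>
     (\<forall>I\<in>imag_units.
        openin (top_of_set (slice_plane I)) (\<Omega> \<inter> slice_plane I) \<and>
        connected (\<Omega> \<inter> slice_plane I) \<and> \<Omega> \<inter> slice_plane I \<noteq> {})"

definition axially_symmetric :: "quat set \<Rightarrow> bool" where
  "axially_symmetric \<Omega> \<longleftrightarrow>
     (\<forall>x y. \<forall>I\<in>imag_units. slice_point x y I \<in> \<Omega> \<longrightarrow> (\<forall>L\<in>imag_units. slice_point x y L \<in> \<Omega>))"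

text \<open>
  A function on a set \<open>\<Omega>\<close> is a total function whose values outside \<open>\<Omega>\<close> are ignored. The
  definition of slice regularity is meant for \<open>\<Omega>\<close> whose slices are open in the slice
  planes, so that the partial derivatives \<open>fx\<close> and \<open>fy\<close> depend only on the values on \<open>\<Omega>\<close>.
\<close>

definition left_holomorphic_on_slice :: "quat \<Rightarrow> quat set \<Rightarrow> (quat \<Rightarrow> quat) \<Rightarrow> bool" where
  "left_holomorphic_on_slice I \<Omega> f \<longleftrightarrow>
     (let D = {(x, y). slice_point x y I \<in> \<Omega>} in
      \<exists>fx fy :: real \<times> real \<Rightarrow> quat.
        continuous_on D fx \<and> continuous_on D fy \<and>
        (\<forall>(x, y)\<in>D.
           ((\<lambda>t. f (slice_point t y I)) has_vector_derivative fx (x, y)) (at x) \<and>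
           ((\<lambda>t. f (slice_point x t I)) has_vector_derivative fy (x, y)) (at y) \<and>
           (1 / 2) *\<^sub>R (fx (x, y) + I * fy (x, y)) = 0))"

definition slice_regular_on :: "quat set \<Rightarrow> (quat \<Rightarrow> quat) \<Rightarrow> bool" where
  "slice_regular_on \<Omega> f \<longleftrightarrow> (\<forall>I\<in>imag_units. left_holomorphic_on_slice I \<Omega> f)"

end

theory Submission
  imports Defs
begin

text \<open>
  On the slice of \<open>I\<close>, take the branch of \<open>log (1 + z\<^sup>2)\<close> that is real on the real axis and is
  cut along two rays, from \<open>I\<close> upwards and from \<open>-I\<close> downwards, whose slope is governed by the
  first imaginary coordinate \<open>t\<close> of \<open>I\<close>. The rays tilt with \<open>I\<close> and sweep over the sphere
  \<open>2 \<S>\<close>: its point \<open>2 I\<close> lies on the ray for \<open>t = 0\<close> and on different sides of it for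
  \<open>t > 0\<close> and \<open>t < 0\<close>, so the value there is \<open>ln 3 - \<pi> I\<close> or \<open>ln 3 + \<pi> I\<close> respectively.
  The representation formula would force a single expression that is affine in \<open>I\<close>.
\<close>

section \<open>Slice coordinates\<close>

lemma QRe_of_real [simp]: "QRe (of_real r) = r"
  and QIm1_of_real [simp]: "QIm1 (of_real r) = 0"
  and QIm2_of_real [simp]: "QIm2 (of_real r) = 0"
  and QIm3_of_real [simp]: "QIm3 (of_real r) = 0"
  by (simp_all add: of_real_def)

lemma bounded_linear_QRe: "bounded_linear QRe"
  and bounded_linear_QIm1: "bounded_linear QIm1"
proof -
  have "QRe = (\<lambda>q. inner q (Quat 1 0 0 0))" "QIm1 = (\<lambda>q. inner q (Quat 0 1 0 0))"
    by (simp_all add: fun_eq_iff inner_quat_def)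
  then show "bounded_linear QRe" "bounded_linear QIm1"
    using bounded_linear_inner_left by metis+
qed

lemmas continuous_on_QRe [continuous_intros] = bounded_linear.continuous_on [OF bounded_linear_QRe]
lemmas continuous_on_QIm1 [continuous_intros] = bounded_linear.continuous_on [OF bounded_linear_QIm1]

text \<open>A nonzero real part would make the imaginary components vanish, leaving a real number of
  square -1.\<close>

lemma imag_units_iff:
  "I \<in> imag_units \<longleftrightarrow> QRe I = 0 \<and> (QIm1 I)\<^sup>2 + (QIm2 I)\<^sup>2 + (QIm3 I)\<^sup>2 = 1"
proof
  assume "I \<in> imag_units"
  then have *: "QRe I * QRe I - QIm1 I * QIm1 I - QIm2 I * QIm2 I - QIm3 I * QIm3 I = -1"
    "QRe I * QIm1 I = 0" "QRe I * QIm2 I = 0" "QRe I * QIm3 I = 0"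
    by (auto simp: imag_units_def power2_eq_square quat_eq_iff)
  have "QRe I = 0"
  proof (rule ccontr)
    assume "QRe I \<noteq> 0"
    with * have "QRe I * QRe I = -1" by simp
    then show False by (metis neg_0_le_iff_le not_one_le_zero zero_le_square)
  qed
  with * show "QRe I = 0 \<and> (QIm1 I)\<^sup>2 + (QIm2 I)\<^sup>2 + (QIm3 I)\<^sup>2 = 1"
    by (simp add: power2_eq_square)
qed (simp add: imag_units_def power2_eq_square quat_eq_iff)

lemma norm_imag_unit: "I \<in> imag_units \<Longrightarrow> norm I = 1"
  by (simp add: imag_units_iff norm_quat_def)

lemma imag_unit_mult_self: "I \<in> imag_units \<Longrightarrow> I * (I * q) = - q"
  by (simp add: imag_units_def power2_eq_square flip: mult.assoc)

lemma QRe_slice_point: "I \<in> imag_units \<Longrightarrow> QRe (slice_point x y I) = x"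
  and QIm1_slice_point: "I \<in> imag_units \<Longrightarrow> QIm1 (slice_point x y I) = y * QIm1 I"
  by (simp_all add: slice_point_def imag_units_iff)

definition qvec :: "quat \<Rightarrow> quat" where
  "qvec q = q - of_real (QRe q)"

lemma qvec_slice_point: "I \<in> imag_units \<Longrightarrow> qvec (slice_point x y I) = of_real y * I"
  by (simp add: qvec_def QRe_slice_point) (simp add: slice_point_def)

lemma norm_qvec_slice_point: "I \<in> imag_units \<Longrightarrow> norm (qvec (slice_point x y I)) = \<bar>y\<bar>"
  by (simp add: qvec_slice_point norm_mult norm_imag_unit)

text \<open>The unit is the normalised vector part; a real quaternion lies in every slice plane, so
  an arbitrary unit is chosen for it. This later exhibits the domain as the union of its
  slices.\<close>

lemma slice_point_exhaust:
  obtains x y I where "I \<in> imag_units" "q = slice_point x y I"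
proof (cases "qvec q = 0")
  case True
  have "q = slice_point (QRe q) 0 (Quat 0 1 0 0)"
    using True by (simp add: qvec_def slice_point_def)
  then show ?thesis using that[of "Quat 0 1 0 0"] by (simp add: imag_units_iff)
next
  case False
  have n: "(norm (qvec q))\<^sup>2 = (QIm1 q)\<^sup>2 + (QIm2 q)\<^sup>2 + (QIm3 q)\<^sup>2"
    by (simp add: norm_quat_def qvec_def)
  have "inverse (norm (qvec q)) *\<^sub>R qvec q \<in> imag_units"
    using False
    by (simp add: imag_units_iff qvec_def[of q] power_mult_distrib power_inverse
        flip: distrib_left n)
  moreover have "q = slice_point (QRe q) (norm (qvec q)) (inverse (norm (qvec q)) *\<^sub>R qvec q)"
    using False by (simp add: slice_point_def of_real_def) (simp add: qvec_def of_real_def)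
  ultimately show ?thesis using that by blast
qed

text \<open>Transports complex analysis to a slice by sending \<open>\<i>\<close> to
  \<open>I\<close>. The parameter may be any quaternion; the value 0 occurs in the logarithm below
  at real points.\<close>

definition slice_embed :: "quat \<Rightarrow> complex \<Rightarrow> quat" where
  "slice_embed I z = slice_point (Re z) (Im z) I"

lemma slice_embed_Complex: "slice_point x y I = slice_embed I (Complex x y)"
  by (simp add: slice_embed_def)

lemma bounded_linear_slice_embed: "bounded_linear (slice_embed I)"
  unfolding slice_embed_def slice_point_def
  by (intro bounded_linear_add bounded_linear_compose[OF bounded_linear_of_real bounded_linear_Re]
      bounded_linear_compose[OF bounded_linear_mult_left
        bounded_linear_compose[OF bounded_linear_of_real bounded_linear_Im]])

lemma slice_embed_ii_mult:
  "I \<in> imag_units \<Longrightarrow> slice_embed I (\<i> * z) = I * slice_embed I z"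
  by (simp add: slice_embed_def slice_point_def of_real_def distrib_left imag_units_def
      power2_eq_square)

text \<open>\<open>I\<close> and \<open>- I\<close> span the same slice plane, with conjugate
  coordinates.\<close>

lemma slice_embed_uminus_cnj: "slice_embed (- I) (cnj z) = slice_embed I z"
  by (simp add: slice_embed_def slice_point_def)

section \<open>The slit planes\<close>

definition slit :: "real \<Rightarrow> complex set" where
  "slit t = {z. \<not> (1 \<le> Im z \<and> Re z = t * (Im z - 1)) \<and>
               \<not> (Im z \<le> - 1 \<and> Re z = t * (Im z + 1))}"

text \<open>Multiplication by \<open>1 + \<i> t\<close> turns the values of
  \<open>1 + \<i> z\<close> along the tilted ray onto the negative real axis, the cut of the
  principal \<open>Ln\<close>.\<close>

lemma nonpos_Reals_upper_ray:
  "Complex 1 t * (1 + \<i> * z) \<in> \<real>\<^sub>\<le>\<^sub>0 \<longleftrightarrow> 1 \<le> Im z \<and> Re z = t * (Im z - 1)"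
proof -
  have "1 - Im z - t * (t * (Im z - 1)) = (1 + t\<^sup>2) * (1 - Im z)"
    by (simp add: algebra_simps power2_eq_square)
  moreover have "1 + t\<^sup>2 > 0" by (simp add: add_pos_nonneg)
  ultimately have "1 - Im z - t * (t * (Im z - 1)) \<le> 0 \<longleftrightarrow> 1 \<le> Im z"
    by (simp add: mult_le_0_iff)
  moreover have "Re z + t * (1 - Im z) = 0 \<longleftrightarrow> Re z = t * (Im z - 1)"
    by (auto simp: algebra_simps)
  ultimately show ?thesis by (auto simp: complex_nonpos_Reals_iff)
qed

text \<open>The same factor serves the lower ray, because \<open>z \<mapsto> - z\<close> exchanges
  the two rays and the two linear factors of \<open>1 + z\<^sup>2\<close>.\<close>

lemma nonpos_Reals_lower_ray:
  "Complex 1 t * (1 - \<i> * z) \<in> \<real>\<^sub>\<le>\<^sub>0 \<longleftrightarrow> Im z \<le> - 1 \<and> Re z = t * (Im z + 1)"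
proof -
  have "1 + Im z + t * (t * (Im z + 1)) = (1 + t\<^sup>2) * (1 + Im z)"
    by (simp add: algebra_simps power2_eq_square)
  moreover have "1 + t\<^sup>2 > 0" by (simp add: add_pos_nonneg)
  ultimately have "1 + Im z + t * (t * (Im z + 1)) \<le> 0 \<longleftrightarrow> Im z \<le> -1"
    by (auto simp add: mult_le_0_iff)
  moreover have "t * (1 + Im z) - Re z = 0 \<longleftrightarrow> Re z = t * (Im z + 1)"
    by (auto simp: algebra_simps)
  ultimately show ?thesis by (auto simp: complex_nonpos_Reals_iff)
qed

lemma slit_iff:
  "z \<in> slit t \<longleftrightarrow> Complex 1 t * (1 + \<i> * z) \<notin> \<real>\<^sub>\<le>\<^sub>0 \<and> Complex 1 t * (1 - \<i> * z) \<notin> \<real>\<^sub>\<le>\<^sub>0"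
  by (simp only: slit_def nonpos_Reals_upper_ray nonpos_Reals_lower_ray mem_Collect_eq)

lemma open_slit: "open (slit t)"
proof -
  have "slit t = (\<lambda>z. Complex 1 t * (1 + \<i> * z)) -` (- \<real>\<^sub>\<le>\<^sub>0)
      \<inter> (\<lambda>z. Complex 1 t * (1 - \<i> * z)) -` (- \<real>\<^sub>\<le>\<^sub>0)"
    by (auto simp: slit_iff)
  then show ?thesis
    by (auto intro!: open_Int open_vimage continuous_intros simp: open_Compl)
qed

text \<open>The plane is covered by the strip between the branch points and four convex pieces,
  lying left and right of the lines through the rays. Each piece meets the strip, and 0 is common to
  the resulting unions.\<close>

lemma connected_slit: "connected (slit t)"
proof -
  define S where "S = {z. - 1 < Im z} \<inter> {z. Im z < 1}"
  define UL where "UL = {z. 0 < Im z} \<inter> {z. inner (Complex 1 (- t)) z < - t}"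
  define UR where "UR = {z. 0 < Im z} \<inter> {z. inner (Complex 1 (- t)) z > - t}"
  define LL where "LL = {z. Im z < 0} \<inter> {z. inner (Complex 1 (- t)) z < t}"
  define LR where "LR = {z. Im z < 0} \<inter> {z. inner (Complex 1 (- t)) z > t}"
  note defs = S_def UL_def UR_def LL_def LR_def
  have "convex S" "convex UL" "convex UR" "convex LL" "convex LR"
    unfolding defs
    by (intro convex_Int convex_halfspace_Im_lt convex_halfspace_Im_gt
        convex_halfspace_lt convex_halfspace_gt)+
  then have conn: "connected S" "connected UL" "connected UR" "connected LL" "connected LR"
    by (auto intro: convex_connected)
  \<comment> \<open>At heights \<open>1/2\<close> and \<open>- 1/2\<close> the two lines have real
    part \<open>- t/2\<close> and \<open>t/2\<close>, so real parts of modulus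
    \<open>\<bar>t\<bar> + 1\<close> fall on the intended side.\<close>
  have "Complex (- \<bar>t\<bar> - 1) (1/2) \<in> S \<inter> UL" "Complex (\<bar>t\<bar> + 1) (1/2) \<in> S \<inter> UR"
    "Complex (- \<bar>t\<bar> - 1) (- 1/2) \<in> S \<inter> LL" "Complex (\<bar>t\<bar> + 1) (- 1/2) \<in> S \<inter> LR"
    by (auto simp: defs inner_complex_def)
  then have "connected (S \<union> UL)" "connected (S \<union> UR)" "connected (S \<union> LL)" "connected (S \<union> LR)"
    by (blast intro: connected_Un conn)+
  moreover have "0 \<in> S" by (simp add: S_def)
  ultimately have "connected (\<Union> {S \<union> UL, S \<union> UR, S \<union> LL, S \<union> LR})"
    by (intro connected_Union) auto
  also have "\<Union> {S \<union> UL, S \<union> UR, S \<union> LL, S \<union> LR} = slit t"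
  proof (rule set_eqI)
    fix z
    show "z \<in> \<Union> {S \<union> UL, S \<union> UR, S \<union> LL, S \<union> LR} \<longleftrightarrow> z \<in> slit t"
      unfolding defs slit_def inner_complex_def
      by (simp add: right_diff_distrib distrib_left) linarith
  qed
  finally show ?thesis .
qed

section \<open>A branch of the logarithm of \<open>1 + z\<^sup>2\<close> on each slit plane\<close>

definition slit_log :: "real \<Rightarrow> complex \<Rightarrow> complex" where
  "slit_log t z =
     Ln (Complex 1 t * (1 + \<i> * z)) + Ln (Complex 1 t * (1 - \<i> * z)) - 2 * Ln (Complex 1 t)"

lemma Complex_1_not_nonpos: "Complex 1 t \<notin> \<real>\<^sub>\<le>\<^sub>0"
  by (simp add: complex_nonpos_Reals_iff)

text \<open>The constant rotation cancels in each logarithmic derivative; the result is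
  \<open>2 z / (1 + z\<^sup>2)\<close> for every slope.\<close>

lemma slit_log_has_field_derivative:
  assumes "z \<in> slit t"
  shows "(slit_log t has_field_derivative (\<i> / (1 + \<i> * z) - \<i> / (1 - \<i> * z))) (at z)"
proof -
  have nz: "Complex 1 t \<noteq> 0" "1 + \<i> * z \<noteq> 0" "1 - \<i> * z \<noteq> 0"
    using assms Complex_1_not_nonpos[of t] by (auto simp: slit_iff)
  have "((\<lambda>z. Ln (Complex 1 t * (1 + \<i> * z))) has_field_derivative
      inverse (Complex 1 t * (1 + \<i> * z)) * (Complex 1 t * \<i>)) (at z)"
    "((\<lambda>z. Ln (Complex 1 t * (1 - \<i> * z))) has_field_derivative
      inverse (Complex 1 t * (1 - \<i> * z)) * (Complex 1 t * - \<i>)) (at z)"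
    using assms unfolding slit_iff
    by (auto intro!: DERIV_chain2[OF has_field_derivative_Ln] derivative_eq_intros)
  then have "(slit_log t has_field_derivative
      inverse (Complex 1 t * (1 + \<i> * z)) * (Complex 1 t * \<i>)
      + inverse (Complex 1 t * (1 - \<i> * z)) * (Complex 1 t * - \<i>) - 0) (at z)"
    unfolding slit_log_def by (intro DERIV_diff DERIV_add DERIV_const)
  moreover have "inverse (a * b) * (a * c) = c / b" if "a \<noteq> 0" for a b c :: complex
    using that by (simp add: field_simps)
  ultimately show ?thesis using nz by simp
qed

text \<open>Conjugation swaps the two logarithms and reverses the slope. As \<open>- I\<close> has
  the opposite first coordinate, the values computed from \<open>I\<close> and from
  \<open>- I\<close> will agree.\<close>

lemma slit_log_cnj:
  assumes "z \<in> slit t"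
  shows "slit_log (- t) (cnj z) = cnj (slit_log t z)"
proof -
  have "cnj (Ln (Complex 1 t * (1 + \<i> * z))) = Ln (Complex 1 (- t) * (1 - \<i> * cnj z))"
    "cnj (Ln (Complex 1 t * (1 - \<i> * z))) = Ln (Complex 1 (- t) * (1 + \<i> * cnj z))"
    "cnj (Ln (Complex 1 t)) = Ln (Complex 1 (- t))"
    using assms Complex_1_not_nonpos[of t] by (simp_all add: slit_iff cnj_Ln complex_cnj)
  then show ?thesis by (simp add: slit_log_def)
qed

text \<open>Both arguments lie strictly between \<open>- pi/2\<close> and \<open>pi/2\<close>, so
  their sum stays in the principal range.\<close>

lemma Ln_mult_Re_pos:
  assumes "0 < Re a" "0 < Re b"
  shows "Ln (a * b) = Ln a + Ln b"
proof -
  have "a \<noteq> 0" "b \<noteq> 0" using assms by auto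
  moreover have "\<bar>Im (Ln a)\<bar> < pi/2" "\<bar>Im (Ln b)\<bar> < pi/2"
    using assms by (blast intro: Re_Ln_pos_lt_imp)+
  ultimately show ?thesis by (intro Ln_times_simple) auto
qed

text \<open>On the real axis all factors have real part 1, so the rotations split off and cancel
  against \<open>2 * Ln (Complex 1 t)\<close>. Hence the branches for all slopes agree where the
  slices meet.\<close>

lemma slit_log_of_real: "slit_log t (of_real x) = of_real (ln (1 + x\<^sup>2))"
proof -
  have "slit_log t (of_real x) = Ln (1 + \<i> * of_real x) + Ln (1 - \<i> * of_real x)"
    by (simp add: slit_log_def Ln_mult_Re_pos)
  also have "\<dots> = Ln ((1 + \<i> * of_real x) * (1 - \<i> * of_real x))"
    by (simp add: Ln_mult_Re_pos)
  also have "(1 + \<i> * of_real x) * (1 - \<i> * of_real x) = of_real (1 + x\<^sup>2)"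
    by (simp add: complex_eq_iff power2_eq_square)
  also have "Ln (of_real (1 + x\<^sup>2)) = of_real (ln (1 + x\<^sup>2))"
    by (intro Ln_of_real) (simp add: add_pos_nonneg)
  finally show ?thesis .
qed

text \<open>Here \<open>1 + \<i> z\<close> is -1, and the principal argument of
  \<open>- Complex 1 t\<close> differs from that of \<open>Complex 1 t\<close> by \<open>pi\<close>,
  with sign opposite to that of \<open>t\<close>. The other factor, 3, gives the real part.\<close>

lemma slit_log_2i:
  assumes "t \<noteq> 0"
  shows "slit_log t (2 * \<i>) = Complex (ln 3) (- (sgn t * pi))"
proof -
  have "Complex 1 t \<noteq> 0" by (simp add: complex_eq_iff)
  then have "Ln (- Complex 1 t) = Ln (Complex 1 t) - \<i> * (sgn t * pi)"
    using assms by (simp add: Ln_minus sgn_if)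
  moreover have "Ln (Complex 1 t * 3) = Ln (Complex 1 t) + Ln 3"
    by (simp add: Ln_mult_Re_pos)
  moreover have "Ln (3::complex) = of_real (ln 3)"
    using Ln_of_real[of 3] by simp
  moreover have "1 + \<i> * (2 * \<i>) = -1" "1 - \<i> * (2 * \<i>) = 3"
    by (simp_all add: complex_eq_iff)
  ultimately show ?thesis
    unfolding slit_log_def by (simp only:) (simp add: complex_eq_iff)
qed

section \<open>The slit domain and the logarithm on it\<close>

text \<open>For the unit \<open>qvec q / norm (qvec q)\<close> this removes the upper ray; the lower
  ray of \<open>I\<close> is the upper ray of \<open>- I\<close>. Multiplying the ray equation by
  the norm avoids division and keeps the condition visibly closed.\<close>

definition slit_domain :: "quat set" where
  "slit_domain = {q. \<not> (1 \<le> norm (qvec q) \<and>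
     QRe q * norm (qvec q) = QIm1 q * (norm (qvec q) - 1))}"

text \<open>Cancelling the nonzero factor \<open>Im z\<close> gives the upper or the lower ray
  according to its sign; real points lie on neither.\<close>

lemma slice_embed_in_slit_domain_iff:
  assumes "I \<in> imag_units"
  shows "slice_embed I z \<in> slit_domain \<longleftrightarrow> z \<in> slit (QIm1 I)"
proof -
  let ?t = "QIm1 I"
  have *: "slice_embed I z \<in> slit_domain \<longleftrightarrow>
      \<not> (1 \<le> \<bar>Im z\<bar> \<and> Re z * \<bar>Im z\<bar> = Im z * ?t * (\<bar>Im z\<bar> - 1))"
    using assms by (simp add: slit_domain_def slice_embed_def norm_qvec_slice_point
        QRe_slice_point QIm1_slice_point)
  consider "Im z > 0" | "Im z < 0" | "Im z = 0" by linarith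
  then show ?thesis
  proof cases
    case 1
    then have "Re z * \<bar>Im z\<bar> = Im z * ?t * (\<bar>Im z\<bar> - 1) \<longleftrightarrow> Im z * Re z = Im z * (?t * (Im z - 1))"
      by (simp add: mult_ac)
    with 1 show ?thesis by (simp add: * slit_def)
  next
    case 2
    then have "Re z * \<bar>Im z\<bar> = Im z * ?t * (\<bar>Im z\<bar> - 1) \<longleftrightarrow> Im z * Re z = Im z * (?t * (Im z + 1))"
      by (auto simp: algebra_simps)
    with 2 show ?thesis by (auto simp: * slit_def)
  qed (simp add: * slit_def)
qed

lemma slit_domain_Int_slice_plane:
  assumes "I \<in> imag_units"
  shows "slit_domain \<inter> slice_plane I = slice_embed I ` slit (QIm1 I)"
proof -
  have "slice_plane I = range (slice_embed I)"
  proof (intro set_eqI iffI)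
    fix q assume "q \<in> slice_plane I"
    then obtain x y where "q = slice_point x y I"
      by (auto simp: slice_plane_def)
    then show "q \<in> range (slice_embed I)"
      by (simp only: slice_embed_Complex rangeI)
  next
    fix q assume "q \<in> range (slice_embed I)"
    then show "q \<in> slice_plane I"
      unfolding slice_plane_def slice_embed_def by blast
  qed
  then show ?thesis
    by (auto simp: slice_embed_in_slit_domain_iff[OF assms])
qed

lemma open_slit_domain: "open slit_domain"
proof -
  have "closed ({q. 1 \<le> norm (qvec q)} \<inter>
      {q. QRe q * norm (qvec q) = QIm1 q * (norm (qvec q) - 1)})"
    unfolding qvec_def
    by (intro closed_Int closed_Collect_le closed_Collect_eq continuous_intros)
  moreover have "slit_domain = - ({q. 1 \<le> norm (qvec q)} \<inter>
      {q. QRe q * norm (qvec q) = QIm1 q * (norm (qvec q) - 1)})"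
    by (auto simp: slit_domain_def)
  ultimately show ?thesis by (metis open_Compl)
qed

lemma zero_in_slit: "0 \<in> slit t"
  by (simp add: slit_def)

lemma slice_embed_0: "slice_embed I 0 = 0"
  by (simp add: slice_embed_def slice_point_def)

lemma s_domain_slit_domain: "s_domain slit_domain"
proof -
  have conn: "connected (slit_domain \<inter> slice_plane I)" and zero: "0 \<in> slit_domain \<inter> slice_plane I"
    if "I \<in> imag_units" for I
    unfolding slit_domain_Int_slice_plane[OF that]
    by (auto intro!: connected_continuous_image connected_slit zero_in_slit
        linear_continuous_on bounded_linear_slice_embed image_eqI[of _ _ 0] simp: slice_embed_0)
  have "slit_domain = (\<Union>I\<in>imag_units. slit_domain \<inter> slice_plane I)"
    unfolding slice_plane_def by (auto intro: slice_point_exhaust)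
  \<comment> \<open>All slices share the point 0.\<close>
  moreover have "connected (\<Union>I\<in>imag_units. slit_domain \<inter> slice_plane I)"
    using zero by (intro connected_Union) (auto intro: conn)
  ultimately have "connected slit_domain" by simp
  moreover have "Quat 0 1 0 0 \<in> imag_units" by (simp add: imag_units_iff)
  with zero have "0 \<in> slit_domain" by blast
  then have "slit_domain \<inter> \<real> \<noteq> {}" using Reals_0 by blast
  moreover have "openin (top_of_set (slice_plane I)) (slit_domain \<inter> slice_plane I)" for I
    by (subst Int_commute) (rule openin_open_Int[OF open_slit_domain])
  ultimately show ?thesis
    unfolding s_domain_def
    by (intro conjI ballI conn open_slit_domain) (assumption | use zero in fast)+
qed

text \<open>
  For real \<open>q\<close> both quotients by \<open>norm (qvec q)\<close> are \<open>0\<close>; this is harmless because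
  \<^const>\<open>slit_log\<close> does not depend on \<open>t\<close> and is real there.
\<close>

definition quat_log :: "quat \<Rightarrow> quat" where
  "quat_log q = slice_embed (qvec q /\<^sub>R norm (qvec q))
     (slit_log (QIm1 q / norm (qvec q)) (Complex (QRe q) (norm (qvec q))))"

text \<open>The definition always uses upper half-plane coordinates. Below the real axis these
  belong to \<open>- I\<close>, \<open>cnj z\<close> and the opposite slope, which
  \<open>slit_log_cnj\<close> converts back.\<close>

lemma quat_log_slice_embed:
  assumes I: "I \<in> imag_units" and z: "z \<in> slit (QIm1 I)"
  shows "quat_log (slice_embed I z) = slice_embed I (slit_log (QIm1 I) z)"
proof -
  have *: "quat_log (slice_embed I z) = slice_embed ((of_real (Im z) * I) /\<^sub>R \<bar>Im z\<bar>)
     (slit_log (Im z * QIm1 I / \<bar>Im z\<bar>) (Complex (Re z) \<bar>Im z\<bar>))"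
    using I by (simp add: quat_log_def slice_embed_def QRe_slice_point QIm1_slice_point
        qvec_slice_point norm_mult norm_imag_unit)
  consider "Im z > 0" | "Im z < 0" | "Im z = 0" by linarith
  then show ?thesis
  proof cases
    case 1
    then have "(of_real (Im z) * I) /\<^sub>R \<bar>Im z\<bar> = I"
      by (simp add: of_real_def)
    with 1 show ?thesis by (simp add: *)
  next
    case 2
    then have "(of_real (Im z) * I) /\<^sub>R \<bar>Im z\<bar> = - I"
      by (simp add: of_real_def)
    moreover have "Complex (Re z) \<bar>Im z\<bar> = cnj z" "Im z * QIm1 I / \<bar>Im z\<bar> = - QIm1 I"
      using 2 by (simp_all add: complex_eq_iff)
    ultimately show ?thesis
      by (simp only: * slit_log_cnj[OF z] slice_embed_uminus_cnj)
  next
    case 3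
    then have x: "Complex (Re z) \<bar>Im z\<bar> = of_real (Re z)" and z: "z = of_real (Re z)"
      by (simp_all add: complex_eq_iff)
    have "quat_log (slice_embed I z) = of_real (ln (1 + (Re z)\<^sup>2))"
      unfolding * x slit_log_of_real by (simp add: slice_embed_def slice_point_def)
    also have "\<dots> = slice_embed I (slit_log (QIm1 I) z)"
      by (subst z, simp only: slit_log_of_real) (simp add: slice_embed_def slice_point_def)
    finally show ?thesis .
  qed
qed

section \<open>Slice regularity of the logarithm\<close>

lemma slice_regular_quat_log: "slice_regular_on slit_domain quat_log"
  unfolding slice_regular_on_def
proof
  fix I assume I: "I \<in> imag_units"
  define D where "D = {(x, y). slice_point x y I \<in> slit_domain}"
  define d where "d = (\<lambda>z. \<i> / (1 + \<i> * z) - \<i> / (1 - \<i> * z))"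
  define fx where "fx = (\<lambda>(x, y). slice_embed I (d (Complex x y)))"
  define fy where "fy = (\<lambda>(x, y). slice_embed I (\<i> * d (Complex x y)))"
  have D: "(x, y) \<in> D \<longleftrightarrow> Complex x y \<in> slit (QIm1 I)" for x y
    using I by (simp add: D_def slice_embed_Complex slice_embed_in_slit_domain_iff)
  have nz: "1 + \<i> * Complex x y \<noteq> 0" "1 - \<i> * Complex x y \<noteq> 0" if "(x, y) \<in> D" for x y
    using that unfolding D slit_iff by auto
  have cont_d: "continuous_on D (\<lambda>p. d (Complex (fst p) (snd p)))"
    unfolding d_def using nz by (intro continuous_intros) auto
  have cont: "continuous_on D fx" "continuous_on D fy"
    unfolding fx_def fy_def case_prod_unfold
    by (intro bounded_linear.continuous_on[OF bounded_linear_slice_embed]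
        continuous_on_mult continuous_on_const cont_d)+
  have deriv:
    "((\<lambda>s. quat_log (slice_point s y I)) has_vector_derivative fx (x, y)) (at x)"
    "((\<lambda>s. quat_log (slice_point x s I)) has_vector_derivative fy (x, y)) (at y)"
    "(1 / 2) *\<^sub>R (fx (x, y) + I * fy (x, y)) = 0" if "(x, y) \<in> D" for x y
  proof -
    \<comment> \<open>Both partial derivatives at once: \<open>g\<close> will be a horizontal line
      with \<open>g' = 1\<close> or a vertical one with \<open>g' = \<i>\<close>.\<close>
    have along: "((\<lambda>s. quat_log (slice_embed I (g s))) has_vector_derivative
        slice_embed I (g' * d (g r))) (at r)"
      if g: "(g has_vector_derivative g') (at r)" "continuous_on UNIV g" "g r \<in> slit (QIm1 I)"
      for g :: "real \<Rightarrow> complex" and g' r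
    proof -
      have "((slit_log (QIm1 I) \<circ> g) has_vector_derivative (g' * d (g r))) (at r)"
        using field_vector_diff_chain_at[OF g(1) slit_log_has_field_derivative[OF g(3)]]
        by (simp add: d_def)
      then have "((\<lambda>s. slice_embed I (slit_log (QIm1 I) (g s))) has_vector_derivative
          slice_embed I (g' * d (g r))) (at r)"
        using bounded_linear.has_vector_derivative[OF bounded_linear_slice_embed]
        by (fastforce simp: o_def)
      \<comment> \<open>The complex formula for \<open>quat_log\<close> is known only on the slit
        plane, so the derivative is transferred on an open set of parameters.\<close>
      moreover have "open (g -` slit (QIm1 I))"
        using open_vimage[OF open_slit g(2)] .
      ultimately show ?thesis
        by (rule has_vector_derivative_transform_within_open)
           (use g(3) I in \<open>auto simp: quat_log_slice_embed\<close>)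
    qed
    have "((\<lambda>s. Complex s y) has_vector_derivative 1) (at x)"
      "((\<lambda>s. Complex x s) has_vector_derivative \<i>) (at y)"
      unfolding Complex_eq
      by (auto intro!: derivative_eq_intros simp: has_vector_derivative_def scaleR_conv_of_real)
    moreover have "continuous_on UNIV (\<lambda>s. Complex s y)" "continuous_on UNIV (Complex x)"
      unfolding Complex_eq by (intro continuous_intros)+
    moreover note that[unfolded D]
    ultimately show "((\<lambda>s. quat_log (slice_point s y I)) has_vector_derivative fx (x, y)) (at x)"
      "((\<lambda>s. quat_log (slice_point x s I)) has_vector_derivative fy (x, y)) (at y)"
      using along[of "\<lambda>s. Complex s y" 1 x] along[of "Complex x" \<i> y]
      by (simp_all add: slice_embed_Complex fx_def fy_def)
    \<comment> \<open>\<open>fy\<close> is \<open>I\<close> times \<open>fx\<close>, and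
      \<open>I\<close> squares to -1.\<close>
    show "(1 / 2) *\<^sub>R (fx (x, y) + I * fy (x, y)) = 0"
      using I by (simp add: fx_def fy_def slice_embed_ii_mult imag_unit_mult_self)
  qed
  show "left_holomorphic_on_slice I slit_domain quat_log"
    unfolding left_holomorphic_on_slice_def Let_def D_def[symmetric]
    using cont deriv by blast
qed

section \<open>Failure of the formula on the sphere of radius 2\<close>

lemma slice_point_0_2_in_slit_domain:
  assumes "I \<in> imag_units"
  shows "slice_point 0 2 I \<in> slit_domain \<longleftrightarrow> QIm1 I \<noteq> 0"
  using slice_embed_in_slit_domain_iff[OF assms, of "Complex 0 2"]
  by (simp add: slice_embed_def slit_def)

lemma quat_log_0_2:
  assumes "I \<in> imag_units" "QIm1 I \<noteq> 0"
  shows "quat_log (slice_point 0 2 I) = slice_point (ln 3) (- (sgn (QIm1 I) * pi)) I"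
proof -
  have "2 * \<i> \<in> slit (QIm1 I)" using assms by (simp add: slit_def)
  from quat_log_slice_embed[OF assms(1) this] show ?thesis
    using assms by (simp add: slice_embed_def slit_log_2i)
qed

theorem proposition8p4:
  shows "\<exists>(\<Omega> :: quat set) (f :: quat \<Rightarrow> quat) (x :: real) (y :: real) I J K.
           s_domain \<Omega> \<and> \<not> axially_symmetric \<Omega> \<and> slice_regular_on \<Omega> f \<and>
           I \<in> imag_units \<and> J \<in> imag_units \<and> K \<in> imag_units \<and> J \<noteq> K \<and>
           slice_point x y I \<in> \<Omega> \<and> slice_point x y J \<in> \<Omega> \<and> slice_point x y K \<in> \<Omega> \<and>
           f (slice_point x y I) \<noteq>
             (I - K) * inverse (J - K) * f (slice_point x y J) +
             (I - J) * inverse (K - J) * f (slice_point x y K)"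
proof -
  \<comment> \<open>\<open>J\<close> and \<open>K\<close> are distinct rational units with the same
    negative first coordinate, opposite in sign to that of \<open>I\<close>. For \<open>L\<close> it
    is 0, so \<open>2 L\<close> lies on a removed ray and breaks axial symmetry.\<close>
  define I where "I = Quat 0 1 0 0"
  define J where "J = Quat 0 (- 3/5) (4/5) 0"
  define K where "K = Quat 0 (- 3/5) (- 4/5) 0"
  define L where "L = Quat 0 0 1 0"
  have units: "I \<in> imag_units" "J \<in> imag_units" "K \<in> imag_units" "L \<in> imag_units"
    by (simp_all add: imag_units_iff I_def J_def K_def L_def power2_eq_square)
  have t: "QIm1 I = 1" "QIm1 J = - 3/5" "QIm1 K = - 3/5" "QIm1 L = 0"
    by (simp_all add: I_def J_def K_def L_def)
  have dom: "slice_point 0 2 I \<in> slit_domain" "slice_point 0 2 J \<in> slit_domain"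
    "slice_point 0 2 K \<in> slit_domain" "slice_point 0 2 L \<notin> slit_domain"
    using units t by (simp_all add: slice_point_0_2_in_slit_domain)
  then have nonsym: "\<not> axially_symmetric slit_domain"
    using units unfolding axially_symmetric_def by blast
  have "J \<noteq> K" by (simp add: J_def K_def)
  \<comment> \<open>The values at \<open>J\<close> and \<open>K\<close> are
    \<open>ln 3 + pi J\<close> and \<open>ln 3 + pi K\<close>, so the right-hand side is
    \<open>ln 3 + pi I\<close>, while the left-hand side is \<open>ln 3 - pi I\<close>; the first
    imaginary coordinate tells them apart.\<close>
  have "QIm1 (quat_log (slice_point 0 2 I)) \<noteq> QIm1
             ((I - K) * inverse (J - K) * quat_log (slice_point 0 2 J) +
             (I - J) * inverse (K - J) * quat_log (slice_point 0 2 K))"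
    using units t
    by (simp add: quat_log_0_2) (simp add: slice_point_def I_def J_def K_def power2_eq_square)
  then have neq: "quat_log (slice_point 0 2 I) \<noteq>
             (I - K) * inverse (J - K) * quat_log (slice_point 0 2 J) +
             (I - J) * inverse (K - J) * quat_log (slice_point 0 2 K)"
    by (rule contrapos_nn) (rule arg_cong)
  show ?thesis
    by (intro exI conjI, rule s_domain_slit_domain, rule nonsym, rule slice_regular_quat_log,
        rule units(1), rule units(2), rule units(3), rule \<open>J \<noteq> K\<close>,
        rule dom(1), rule dom(2), rule dom(3), rule neq)
qed

end
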